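(* Let $X$ and $Y$ be real Banach spaces that are reflexive, strictly convex and Radon-Riesz spaces, and let $A\colon X\to Y$ be a bounded linear operator with metric generalized inverse $A^\dagger\colon\mathcal D(A^\dagger)\subset Y\to X$. Let $p,q\ge1$, and for $y\in Y$ and $\alpha>0$ let $x_\alpha(y)\in X$ be the uniquely determined minimizer over $x\in X$ of the Tikhonov functional $$T_\alpha(x,y)=\|Ax-y\|_Y^p+\alpha\|x\|_X^q .$$ Then the following holds true. (1) For $y\in\mathcal D(A^\dagger)$, and hence when there is a unique minimum norm solution $x_\ast(y)=A^\dagger y$, we have $x_\alpha(y)\to x_\ast(y)$ in norm in $X$ as $\alpha\to0$. (2) For all $y\in Y$ we have $Ax_\alpha(y)\to\pi_{\overline{\mathcal R(A)}}y$ in norm in $Y$ as $\alpha\to0$. Thus the family $x_\alpha\colon Y\to X$, $\alpha>0$, is a parametric regularization.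
   Context: $\mathcal N(A)\subset X$ is the null-space and $\mathcal R(A)\subset Y$ the (not necessarily closed) range of $A$. A Banach space $Z$ is a Radon-Riesz space (has property H) if $z_n\rightharpoonup z$ weakly and $\|z_n\|\to\|z\|$ imply $\|z_n-z\|\to0$. For a closed linear subspace $U$ of a reflexive strictly convex Banach space $Z$, the metric projection $\pi_U\colon Z\to U$ maps $z$ to the unique element of $U$ with $\|z-\pi_U(z)\|=\inf_{u\in U}\|z-u\|$. The duality map is $J_X(x)=\{x'\in X':\langle x',x\rangle=\|x\|_X^2=\|x'\|_{X'}^2\}$, similarly $J_Y$. Put $C_X(A)=\{x\in X:J_X(x)\cap\mathcal N(A)^\perp\neq\emptyset\}$ and $C_Y(A)=\{y\in Y:J_Y(y)\cap\mathcal R(A)^\perp\neq\emptyset\}$ (annihilators in the dual spaces); $A$ maps $C_X(A)$ injectively onto $\mathcal R(A)$. The metric generalized inverse $A^\dagger$ has domain $\mathcal D(A^\dagger)=\mathcal R(A)+C_Y(A)=\{y\in Y:\pi_{\overline{\mathcal R(A)}}y\in\mathcal R(A)\}$ and is given by $A^\dagger y=(A|_{C_X(A)})^{-1}(\pi_{\overline{\mathcal R(A)}}y)$. For $y\in\mathcal D(A^\dagger)$, $x_\ast(y):=A^\dagger y$ is the minimum norm solution, i.e. the unique element of minimal norm among all minimizers of $x\mapsto\|Ax-y\|_Y$ over $X$. A family of mappings $x_\alpha\colon Y\to X$, $\alpha>0$, is called a (parametric) regularization if, as $\alpha\to0$, $x_\alpha(y)\to A^\dagger y$ for all $y\in\mathcal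 D(A^\dagger)$ and $Ax_\alpha(y)\to\pi_{\overline{\mathcal R(A)}}y$ for all $y\in Y$ (norm convergence).
   Formalization: For p = q = 1 the minimizer need not be unique (X = Y = ℝ, A = id, α = 1, y > 0), so uniqueness is asserted only if p > 1 or q > 1; existence and the convergence claims are stated for all p, q ≥ 1 and every choice of minimizers. *)

theory Defs
  imports "HOL-Analysis.Analysis"
begin

definition reflexive_space :: "'a::real_normed_vector itself \<Rightarrow> bool" where
  "reflexive_space _ \<longleftrightarrow>
     (\<forall>\<Phi> :: ('a \<Rightarrow>\<^sub>L real) \<Rightarrow>\<^sub>L real. \<exists>x::'a. \<forall>f. blinfun_apply \<Phi> f = blinfun_apply f x)"

definition strictly_convex_space :: "'a::real_normed_vector itself \<Rightarrow> bool" where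
  "strictly_convex_space _ \<longleftrightarrow>
     (\<forall>x y::'a. norm x = 1 \<longrightarrow> norm y = 1 \<longrightarrow> x \<noteq> y \<longrightarrow> norm ((1/2) *\<^sub>R (x + y)) < 1)"

definition weakly_converges :: "(nat \<Rightarrow> 'a::real_normed_vector) \<Rightarrow> 'a \<Rightarrow> bool" where
  "weakly_converges z l \<longleftrightarrow>
     (\<forall>f :: 'a \<Rightarrow>\<^sub>L real. (\<lambda>n. blinfun_apply f (z n)) \<longlonglongrightarrow> blinfun_apply f l)"

definition radon_riesz_space :: "'a::real_normed_vector itself \<Rightarrow> bool" where
  "radon_riesz_space _ \<longleftrightarrow>
     (\<forall>(z::nat \<Rightarrow> 'a) l. weakly_converges z l \<longrightarrow> (\<lambda>n. norm (z n)) \<longlonglongrightarrow> norm l \<longrightarrow>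
        (\<lambda>n. norm (z n - l)) \<longlonglongrightarrow> 0)"

text \<open>The description is only meaningful when the best approximation exists uniquely, e.g. for a
  closed subspace of a reflexive strictly convex space.\<close>

definition metric_projection :: "'a::real_normed_vector set \<Rightarrow> 'a \<Rightarrow> 'a" where
  "metric_projection U z = (THE u. u \<in> U \<and> norm (z - u) = (INF v\<in>U. norm (z - v)))"

definition duality_map :: "'a::real_normed_vector \<Rightarrow> ('a \<Rightarrow>\<^sub>L real) set" where
  "duality_map x = {f. blinfun_apply f x = (norm x)\<^sup>2 \<and> (norm x)\<^sup>2 = (norm f)\<^sup>2}"

definition annihilator :: "'a::real_normed_vector set \<Rightarrow> ('a \<Rightarrow>\<^sub>L real) set" where
  "annihilator U = {f. \<forall>u\<in>U. blinfun_apply f u = 0}"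

definition null_space :: "('a::real_normed_vector \<Rightarrow>\<^sub>L 'b::real_normed_vector) \<Rightarrow> 'a set" where
  "null_space A = {x. blinfun_apply A x = 0}"

definition C_dom :: "('a::real_normed_vector \<Rightarrow>\<^sub>L 'b::real_normed_vector) \<Rightarrow> 'a set" where
  "C_dom A = {x. duality_map x \<inter> annihilator (null_space A) \<noteq> {}}"

definition C_cod :: "('a::real_normed_vector \<Rightarrow>\<^sub>L 'b::real_normed_vector) \<Rightarrow> 'b set" where
  "C_cod A = {y. duality_map y \<inter> annihilator (range (blinfun_apply A)) \<noteq> {}}"

definition range_projection ::
    "('a::real_normed_vector \<Rightarrow>\<^sub>L 'b::real_normed_vector) \<Rightarrow> 'b \<Rightarrow> 'b" where
  "range_projection A = metric_projection (closure (range (blinfun_apply A)))"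

definition metric_ginv_domain ::
    "('a::real_normed_vector \<Rightarrow>\<^sub>L 'b::real_normed_vector) \<Rightarrow> 'b set" where
  "metric_ginv_domain A = {r + c | r c. r \<in> range (blinfun_apply A) \<and> c \<in> C_cod A}"

text \<open>Total on the type; only the values on \<^term>\<open>metric_ginv_domain A\<close> are meaningful.\<close>

definition metric_ginv ::
    "('a::real_normed_vector \<Rightarrow>\<^sub>L 'b::real_normed_vector) \<Rightarrow> 'b \<Rightarrow> 'a" where
  "metric_ginv A y = the_inv_into (C_dom A) (blinfun_apply A) (range_projection A y)"

definition best_approx_solution ::
    "('a::real_normed_vector \<Rightarrow>\<^sub>L 'b::real_normed_vector) \<Rightarrow> 'b \<Rightarrow> 'a \<Rightarrow> bool" where
  "best_approx_solution A y x \<longleftrightarrow>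
     is_arg_min (\<lambda>x. norm (blinfun_apply A x - y)) (\<lambda>_. True) x"

definition min_norm_solution ::
    "('a::real_normed_vector \<Rightarrow>\<^sub>L 'b::real_normed_vector) \<Rightarrow> 'b \<Rightarrow> 'a \<Rightarrow> bool" where
  "min_norm_solution A y x \<longleftrightarrow> is_arg_min norm (best_approx_solution A y) x"

definition tikhonov ::
    "real \<Rightarrow> real \<Rightarrow> ('a::real_normed_vector \<Rightarrow>\<^sub>L 'b::real_normed_vector) \<Rightarrow> real \<Rightarrow> 'a \<Rightarrow> 'b \<Rightarrow> real"
  where
  "tikhonov p q A \<alpha> x y = norm (blinfun_apply A x - y) powr p + \<alpha> * norm x powr q"

definition tikhonov_minimizer ::
    "real \<Rightarrow> real \<Rightarrow> ('a::real_normed_vector \<Rightarrow>\<^sub>L 'b::real_normed_vector) \<Rightarrow> real \<Rightarrow> 'b \<Rightarrow> 'a \<Rightarrow> bool"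
  where
  "tikhonov_minimizer p q A \<alpha> y x \<longleftrightarrow> is_arg_min (\<lambda>x. tikhonov p q A \<alpha> x y) (\<lambda>_. True) x"

definition parametric_regularization ::
    "('a::real_normed_vector \<Rightarrow>\<^sub>L 'b::real_normed_vector) \<Rightarrow> (real \<Rightarrow> 'b \<Rightarrow> 'a) \<Rightarrow> bool" where
  "parametric_regularization A x \<longleftrightarrow>
     (\<forall>y\<in>metric_ginv_domain A. ((\<lambda>\<alpha>. x \<alpha> y) \<longlongrightarrow> metric_ginv A y) (at_right 0)) \<and>
     (\<forall>y. ((\<lambda>\<alpha>. blinfun_apply A (x \<alpha> y)) \<longlongrightarrow> range_projection A y) (at_right 0))"

end

theory Submission
  imports Defs
begin

text \<open>Everything rests on comparing a minimizer $x_\alpha$ with fixed competitors. Comparing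
  the functional at $x_\alpha$ with its value at an arbitrary $z$ and letting $\alpha \to 0$ shows
  that the residuals $\|A x_\alpha - y\|$ tend to the distance $d$ of $y$ from the range of $A$
  (\<open>tikhonov_residual_upper\<close>). If $y$ has a best approximate solution $z$, then the residual of
  $z$ is minimal, so the penalty term alone forces $\|x_\alpha\| \le \|z\|$
  (\<open>tikhonov_minimizer_norm_le\<close>). In both cases a norm is bounded asymptotically by its value at
  the expected limit. Weak limit points then satisfy the same bound by weak lower semicontinuity,
  strict convexity leaves only one candidate for them, and the Radon-Riesz property upgrades weak
  convergence together with convergence of the norms to norm convergence
  (\<open>radon_riesz_convergence\<close>).

  The weak compactness that this needs comes directly from the Hahn-Banach theorem. For a
  bounded sequence $x_n$ the map $g \mapsto \limsup g(x_n)$ on the dual space is sublinear. Hence it dominates a linear functional that agrees with it at a prescribed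
  $f$, and reflexivity turns this functional into a point $l$ with $g(l) \le \limsup g(x_n)$ for
  all $g$ and equality for $g = f$. The points that satisfy the inequality for all $g$ form the
  asymptotic hull below. If it consists of one point only, then $\limsup f(x_n)$ is the value of $f$ at that point for every
  $f$; replacing $f$ by $-f$ gives the same for the lower limit, so the sequence converges weakly.
  Points of the hull also provide nearest points in closed subspaces and Tikhonov minimizers.

  The Hahn-Banach theorem is used in the form that a sublinear functional is touched by a linear
  one from below at any given point (\<open>Hahn_Banach_sublinear\<close>). Applied to the distance from a
  subspace it yields annihilating functionals, and with them the description of the sets on which
  the metric generalized inverse is built: the duality map of $x$ meets the annihilator of $U$
  exactly if $0$ is a nearest point to $x$ in $U$ (\<open>duality_map_meets_annihilator_iff\<close>). Hence
  \<open>C_dom A\<close> consists of the elements of minimal norm in the fibres of \<open>A\<close>, and \<open>y\<close> lies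
  in the domain of the generalized inverse only if its projection lies in the range itself.\<close>

section \<open>Sublinear functionals and the Hahn-Banach theorem\<close>

text \<open>Only an inequality is required for positive scalars, since this is what infima of sublinear
  expressions satisfy directly; applying it to the inverse scalar gives equality.\<close>

definition sublinear :: "('v::real_vector \<Rightarrow> real) \<Rightarrow> bool" where
  "sublinear p \<longleftrightarrow> (\<forall>x y. p (x + y) \<le> p x + p y) \<and> (\<forall>t>0. \<forall>x. p (t *\<^sub>R x) \<le> t * p x)"

lemma sublinear_add: "sublinear p \<Longrightarrow> p (x + y) \<le> p x + p y"
  and sublinear_scale_le: "sublinear p \<Longrightarrow> t > 0 \<Longrightarrow> p (t *\<^sub>R x) \<le> t * p x"
  by (auto simp: sublinear_def)

lemma sublinear_zero: assumes "sublinear p" shows "p 0 = 0"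
  using sublinear_scale_le[OF assms, of 2 0] sublinear_scale_le[OF assms, of "1/2" 0] by simp

lemma sublinear_scale:
  assumes p: "sublinear p" and t: "t \<ge> 0" shows "p (t *\<^sub>R x) = t * p x"
proof (cases "t = 0")
  case False
  with t have t: "t > 0" by simp
  have "p ((1/t) *\<^sub>R (t *\<^sub>R x)) \<le> (1/t) * p (t *\<^sub>R x)"
    using p t by (intro sublinear_scale_le) auto
  with t have "t * p x \<le> p (t *\<^sub>R x)" by (simp add: field_simps)
  with sublinear_scale_le[OF p t, of x] show ?thesis by simp
qed (simp add: sublinear_zero[OF p])

lemma sublinear_neg: assumes "sublinear p" shows "- p (- x) \<le> p x"
  using sublinear_add[OF assms, of x "- x"] sublinear_zero[OF assms] by simp

lemma le_Inf_add:
  fixes S T :: "real set"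
  assumes "S \<noteq> {}" "T \<noteq> {}" and "\<And>s t. s \<in> S \<Longrightarrow> t \<in> T \<Longrightarrow> c \<le> s + t"
  shows "c \<le> Inf S + Inf T"
proof -
  have "c - s \<le> Inf T" if "s \<in> S" for s
    using assms(2) assms(3)[OF that] by (intro cInf_greatest) (auto simp: algebra_simps)
  then have "c - Inf T \<le> Inf S"
    using assms(1) by (intro cInf_greatest) (auto simp: algebra_simps)
  then show ?thesis by simp
qed

lemma le_mult_Inf:
  fixes S :: "real set"
  assumes "S \<noteq> {}" "r > 0" and "\<And>s. s \<in> S \<Longrightarrow> c \<le> r * s"
  shows "c \<le> r * Inf S"
proof -
  have "c / r \<le> Inf S"
    using assms by (intro cInf_greatest) (auto simp: field_simps)
  then show ?thesis using assms(2) by (simp add: field_simps)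
qed

text \<open>The functional is $q(x) = \inf_{t \ge 0} (p(x + t x_0) - t p(x_0))$. It serves twice in the
  Hahn-Banach theorem: to show that a minimal sublinear functional is odd, and to force the
  linear functional to agree with $p$ at $x_0$.\<close>

lemma sublinear_tilt:
  fixes p :: "'v::real_vector \<Rightarrow> real"
  assumes p: "sublinear p"
  obtains q where "sublinear q" "q \<le> p" "q (- x0) \<le> - p x0"
proof -
  define S where "S = (\<lambda>x. (\<lambda>t. p (x + t *\<^sub>R x0) - t * p x0) ` {0..})"
  have bdd: "bdd_below (S x)" for x
  proof (rule bdd_belowI)
    fix s assume "s \<in> S x"
    then obtain t where t: "t \<ge> 0" "s = p (x + t *\<^sub>R x0) - t * p x0" by (auto simp: S_def)
    have "p (t *\<^sub>R x0) \<le> p (x + t *\<^sub>R x0) + p (- x)"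
      using sublinear_add[OF p, of "x + t *\<^sub>R x0" "- x"] by simp
    then show "- p (- x) \<le> s" using t sublinear_scale[OF p] by simp
  qed
  have ne: "S x \<noteq> {}" for x by (auto simp: S_def)
  have le: "Inf (S x) \<le> p (x + t *\<^sub>R x0) - t * p x0" if "t \<ge> 0" for x t
    using bdd that by (intro cInf_lower) (auto simp: S_def)
  have "sublinear (\<lambda>x. Inf (S x))"
    unfolding sublinear_def
  proof (intro conjI allI impI)
    fix x y
    show "Inf (S (x + y)) \<le> Inf (S x) + Inf (S y)"
    proof (rule le_Inf_add[OF ne ne])
      fix a b assume "a \<in> S x" "b \<in> S y"
      then obtain t s where ts: "t \<ge> 0" "s \<ge> 0" "a = p (x + t *\<^sub>R x0) - t * p x0"
          "b = p (y + s *\<^sub>R x0) - s * p x0"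
        by (auto simp: S_def)
      have "Inf (S (x + y)) \<le> p ((x + y) + (t + s) *\<^sub>R x0) - (t + s) * p x0"
        using ts by (intro le) auto
      also have "(x + y) + (t + s) *\<^sub>R x0 = (x + t *\<^sub>R x0) + (y + s *\<^sub>R x0)"
        by (simp add: algebra_simps)
      finally show "Inf (S (x + y)) \<le> a + b"
        using sublinear_add[OF p, of "x + t *\<^sub>R x0" "y + s *\<^sub>R x0"] ts
        by (simp add: algebra_simps)
    qed
  next
    fix r :: real and x assume r: "r > 0"
    show "Inf (S (r *\<^sub>R x)) \<le> r * Inf (S x)"
    proof (rule le_mult_Inf[OF ne r])
      fix a assume "a \<in> S x"
      then obtain t where t: "t \<ge> 0" "a = p (x + t *\<^sub>R x0) - t * p x0" by (auto simp: S_def)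
      have "Inf (S (r *\<^sub>R x)) \<le> p (r *\<^sub>R x + (r * t) *\<^sub>R x0) - (r * t) * p x0"
        using t r by (intro le) auto
      also have "r *\<^sub>R x + (r * t) *\<^sub>R x0 = r *\<^sub>R (x + t *\<^sub>R x0)"
        by (simp add: algebra_simps)
      finally show "Inf (S (r *\<^sub>R x)) \<le> r * a"
        using sublinear_scale[OF p, of r "x + t *\<^sub>R x0"] r t by (simp add: right_diff_distrib)
    qed
  qed
  moreover have "(\<lambda>x. Inf (S x)) \<le> p"
    using le[of 0] by (auto simp: le_fun_def)
  moreover have "Inf (S (- x0)) \<le> - p x0"
    using le[of 1 "- x0"] sublinear_zero[OF p] by simp
  ultimately show thesis by (rule that)
qed

text \<open>Subadditivity survives the pointwise infimum because two members of the chain are always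
  dominated from below by a single one. The infimum is finite, as every member is bounded below by
  $-p(-x)$.\<close>

lemma sublinear_chain_Inf:
  fixes p :: "'v::real_vector \<Rightarrow> real"
  assumes C: "C \<noteq> {}" "\<And>q. q \<in> C \<Longrightarrow> sublinear q \<and> q \<le> p"
    and chain: "\<And>q r. q \<in> C \<Longrightarrow> r \<in> C \<Longrightarrow> q \<le> r \<or> r \<le> q"
  obtains m where "sublinear m" "\<And>q. q \<in> C \<Longrightarrow> m \<le> q"
proof -
  define S where "S = (\<lambda>x. (\<lambda>q. q x) ` C)"
  have ne: "S x \<noteq> {}" for x using C by (auto simp: S_def)
  have bdd: "bdd_below (S x)" for x
  proof (rule bdd_belowI)
    fix s assume "s \<in> S x"
    then obtain q where q: "q \<in> C" "s = q x" by (auto simp: S_def)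
    have "q (- x) \<le> p (- x)" using C(2)[OF q(1)] by (auto simp: le_fun_def)
    moreover have "- q (- x) \<le> q x" using C(2)[OF q(1)] sublinear_neg by blast
    ultimately show "- p (- x) \<le> s" using q by simp
  qed
  have le: "Inf (S x) \<le> q x" if "q \<in> C" for x q
    using bdd that by (intro cInf_lower) (auto simp: S_def)
  have "sublinear (\<lambda>x. Inf (S x))"
    unfolding sublinear_def
  proof (intro conjI allI impI)
    fix x y
    show "Inf (S (x + y)) \<le> Inf (S x) + Inf (S y)"
    proof (rule le_Inf_add[OF ne ne])
      fix a b assume "a \<in> S x" "b \<in> S y"
      then obtain q r where qr: "q \<in> C" "r \<in> C" "a = q x" "b = r y" by (auto simp: S_def)
      then obtain s where s: "s \<in> C" "s \<le> q" "s \<le> r" using chain[of q r] by blast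
      have "Inf (S (x + y)) \<le> s (x + y)" by (rule le[OF s(1)])
      also have "\<dots> \<le> s x + s y" using C(2)[OF s(1)] sublinear_add by blast
      also have "\<dots> \<le> a + b" using s(2,3) qr by (auto simp: le_fun_def intro: add_mono)
      finally show "Inf (S (x + y)) \<le> a + b" .
    qed
  next
    fix r :: real and x assume r: "r > 0"
    show "Inf (S (r *\<^sub>R x)) \<le> r * Inf (S x)"
    proof (rule le_mult_Inf[OF ne r])
      fix a assume "a \<in> S x"
      then obtain q where q: "q \<in> C" "a = q x" by (auto simp: S_def)
      then show "Inf (S (r *\<^sub>R x)) \<le> r * a"
        using le[OF q(1), of "r *\<^sub>R x"] sublinear_scale_le[of q r x] C(2)[OF q(1)] r by force
    qed
  qed
  with le show thesis using that by (auto simp: le_fun_def)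
qed

text \<open>A minimal sublinear functional $m$ cannot be lowered by tilting, so $m(-x) \le -m(x)$ for all
  $x$, which makes $m$ odd and hence linear. Taking $m$ below the tilt of $p$ at $x_0$ gives
  $m(-x_0) \le -p(x_0)$, that is $m(x_0) \ge p(x_0)$.\<close>

theorem Hahn_Banach_sublinear:
  fixes p :: "'v::real_vector \<Rightarrow> real"
  assumes p: "sublinear p"
  obtains F where "linear F" "F \<le> p" "F x0 = p x0"
proof -
  obtain p' where p': "sublinear p'" "p' \<le> p" "p' (- x0) \<le> - p x0"
    using sublinear_tilt[OF p] .
  define Q where "Q = {q. sublinear q \<and> q \<le> p'}"
  let ?ge = "\<lambda>q r :: 'v \<Rightarrow> real. r \<le> q"
  have "\<exists>m\<in>Q. \<forall>q\<in>Q. ?ge m q \<longrightarrow> q = m"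
  proof (rule predicate_Zorn)
    show "partial_order_on Q (relation_of ?ge Q)"
      by (rule partial_order_on_relation_ofI) auto
  next
    fix C assume C: "C \<in> Chains (relation_of ?ge Q)"
    then have sub: "C \<subseteq> Q" and chain: "\<And>q r. q \<in> C \<Longrightarrow> r \<in> C \<Longrightarrow> q \<le> r \<or> r \<le> q"
      by (auto simp: Chains_def relation_of_def)
    show "\<exists>u\<in>Q. \<forall>a\<in>C. ?ge a u"
    proof (cases "C = {}")
      case True
      then show ?thesis using p' by (auto simp: Q_def)
    next
      case False
      obtain m where m: "sublinear m" "\<And>q. q \<in> C \<Longrightarrow> m \<le> q"
        using sublinear_chain_Inf[OF False _ chain, of p'] sub by (auto simp: Q_def)
      from False obtain q where "q \<in> C" by blast
      with m sub have "m \<le> p'" by (auto simp: Q_def intro: order_trans)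
      with m show ?thesis by (auto simp: Q_def)
    qed
  qed
  then obtain m where m: "sublinear m" "m \<le> p'" and
    min: "\<And>q. sublinear q \<Longrightarrow> q \<le> m \<Longrightarrow> q = m"
    unfolding Q_def by (blast intro: order_trans)
  have odd: "m (- x) = - m x" for x
  proof -
    obtain q where q: "sublinear q" "q \<le> m" "q (- x) \<le> - m x"
      using sublinear_tilt[OF m(1)] .
    with min have "m (- x) \<le> - m x" by metis
    with sublinear_neg[OF m(1), of x] show ?thesis by simp
  qed
  have "linear m"
  proof (rule linearI)
    fix x y
    show "m (x + y) = m x + m y"
      using sublinear_add[OF m(1), of x y] sublinear_add[OF m(1), of "- x" "- y"] odd[of x] odd[of y]
        odd[of "x + y"] by simp
  next
    fix t :: real and x
    show "m (t *\<^sub>R x) = t *\<^sub>R m x"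
    proof (cases "t \<ge> 0")
      case True
      then show ?thesis using sublinear_scale[OF m(1)] by simp
    next
      case False
      then show ?thesis using sublinear_scale[OF m(1), of "- t" x] odd[of "t *\<^sub>R x"] by simp
    qed
  qed
  moreover have "m \<le> p" using m p' by (blast intro: order_trans)
  moreover have "m x0 = p x0"
  proof (rule antisym)
    show "m x0 \<le> p x0" using \<open>m \<le> p\<close> by (auto simp: le_fun_def)
    have "m (- x0) \<le> p' (- x0)" using m(2) by (auto simp: le_fun_def)
    with p'(3) odd[of x0] show "p x0 \<le> m x0" by simp
  qed
  ultimately show thesis by (rule that)
qed

lemma Hahn_Banach_blinfun:
  fixes p :: "'v::real_normed_vector \<Rightarrow> real"
  assumes p: "sublinear p" and bound: "\<And>x. p x \<le> C * norm x" and C: "C \<ge> 0"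
  obtains f :: "'v \<Rightarrow>\<^sub>L real" where "\<And>x. f x \<le> p x" "f x0 = p x0" "norm f \<le> C"
proof -
  obtain F where F: "linear F" "F \<le> p" "F x0 = p x0"
    using Hahn_Banach_sublinear[OF p] .
  have le: "F x \<le> C * norm x" for x
    using F(2) bound[of x] by (auto simp: le_fun_def intro: order_trans)
  have abs: "norm (F x) \<le> norm x * C" for x
    using le[of x] le[of "- x"] linear_neg[OF F(1), of x] by (simp add: mult.commute abs_le_iff)
  have bl: "bounded_linear F"
    using F(1) abs by (intro bounded_linear_intro) (auto simp: linear_add linear_scale)
  have ap: "blinfun_apply (Blinfun F) = F"
    using bl by (rule bounded_linear_Blinfun_apply)
  have "norm (Blinfun F) \<le> C"
    using C abs by (intro norm_blinfun_bound) (auto simp: ap mult.commute)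
  with F show thesis
    by (intro that[of "Blinfun F"]) (auto simp: ap le_fun_def)
qed

lemma blinfun_le_norm:
  fixes f :: "'v::real_normed_vector \<Rightarrow>\<^sub>L real"
  assumes "norm f \<le> C" shows "f x \<le> C * norm x"
proof -
  have "f x \<le> norm (f x)" by simp
  also have "\<dots> \<le> norm f * norm x" by (rule norm_blinfun)
  also have "\<dots> \<le> C * norm x" using assms by (intro mult_right_mono) auto
  finally show ?thesis .
qed

text \<open>This is the quotient seminorm, which measures points modulo $U$.\<close>

lemma sublinear_infdist:
  fixes U :: "'v::real_normed_vector set"
  assumes U: "subspace U"
  shows "sublinear (\<lambda>x. infdist x U)"
proof -
  have ne: "U \<noteq> {}" using subspace_0[OF U] by blast
  have img: "infdist x U = Inf (dist x ` U)" for x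
    using infdist_notempty[OF ne] by simp
  have ne': "dist x ` U \<noteq> {}" for x using ne by simp
  show ?thesis
    unfolding sublinear_def
  proof (intro conjI allI impI)
    fix x y
    show "infdist (x + y) U \<le> infdist x U + infdist y U"
      unfolding img[of x] img[of y]
    proof (rule le_Inf_add[OF ne' ne'])
      fix s t assume "s \<in> dist x ` U" "t \<in> dist y ` U"
      then obtain u v where uv: "u \<in> U" "v \<in> U" "s = dist x u" "t = dist y v" by blast
      have "infdist (x + y) U \<le> dist (x + y) (u + v)"
        using uv subspace_add[OF U] by (intro infdist_le) auto
      also have "\<dots> \<le> s + t" unfolding uv by (rule dist_triangle_add)
      finally show "infdist (x + y) U \<le> s + t" .
    qed
  next
    fix r :: real and x assume r: "r > 0"
    show "infdist (r *\<^sub>R x) U \<le> r * infdist x U"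
      unfolding img[of x]
    proof (rule le_mult_Inf[OF ne' r])
      fix s assume "s \<in> dist x ` U"
      then obtain u where u: "u \<in> U" "s = dist x u" by blast
      have "infdist (r *\<^sub>R x) U \<le> dist (r *\<^sub>R x) (r *\<^sub>R u)"
        using u subspace_scale[OF U] by (intro infdist_le) auto
      then show "infdist (r *\<^sub>R x) U \<le> r * s"
        using u r by (simp add: dist_norm flip: scaleR_diff_right)
    qed
  qed
qed

text \<open>The functional comes from the Hahn-Banach theorem for the distance from $U$; it is bounded by $0$
  on $U$ and therefore vanishes there.\<close>

lemma annihilating_functional:
  fixes U :: "'v::real_normed_vector set"
  assumes U: "subspace U"
  obtains f :: "'v \<Rightarrow>\<^sub>L real" where "f \<in> annihilator U" "f x = infdist x U" "norm f \<le> 1"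
proof -
  have "infdist y U \<le> 1 * norm y" for y
    using infdist_le[OF subspace_0[OF U], of y] by simp
  then obtain f :: "'v \<Rightarrow>\<^sub>L real"
    where f: "\<And>y. f y \<le> infdist y U" "f x = infdist x U" "norm f \<le> 1"
    using Hahn_Banach_blinfun[OF sublinear_infdist[OF U], of 1 x] by auto
  have "f u = 0" if "u \<in> U" for u
    using f(1)[of u] f(1)[of "- u"] that subspace_neg[OF U that] by (simp add: blinfun.minus_right)
  then have "f \<in> annihilator U" by (simp add: annihilator_def)
  then show thesis using f(2,3) by (rule that)
qed

corollary norming_functional:
  fixes x :: "'v::real_normed_vector"
  obtains f :: "'v \<Rightarrow>\<^sub>L real" where "norm f \<le> 1" "f x = norm x"
  using annihilating_functional[OF subspace_single_0, of x] by auto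

section \<open>Weak limit points in reflexive spaces\<close>

text \<open>By Hahn-Banach separation this is the intersection of the closed convex hulls of the tails of the
  sequence. It contains all weak limit points and replaces them in arguments that only need the
  inequality $g(l) \le \limsup g(x_n)$.\<close>

definition asymptotic_hull :: "(nat \<Rightarrow> 'v::real_normed_vector) \<Rightarrow> 'v set" where
  "asymptotic_hull x =
     {l. \<forall>(f :: 'v \<Rightarrow>\<^sub>L real) c. (\<forall>\<^sub>F n in sequentially. f (x n) \<le> c) \<longrightarrow> f l \<le> c}"

lemma asymptotic_hullD:
  fixes f :: "'v::real_normed_vector \<Rightarrow>\<^sub>L real"
  shows "l \<in> asymptotic_hull x \<Longrightarrow> \<forall>\<^sub>F n in sequentially. f (x n) \<le> c \<Longrightarrow> f l \<le> c"
  by (auto simp: asymptotic_hull_def)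

text \<open>The weak compactness principle. The point $l$ represents a linear functional below
  $g \mapsto \limsup g(x_n)$ that touches it at $f$. In particular the hull is not empty.\<close>

lemma asymptotic_hull_attains_limsup:
  fixes x :: "nat \<Rightarrow> 'v::real_normed_vector" and f :: "'v \<Rightarrow>\<^sub>L real"
  assumes refl: "reflexive_space TYPE('v)"
    and bound: "\<forall>\<^sub>F n in sequentially. norm (x n) \<le> C"
  obtains l where "l \<in> asymptotic_hull x" "\<And>c. f l < c \<Longrightarrow> \<forall>\<^sub>F n in sequentially. f (x n) < c"
proof -
  \<comment> \<open>The infimum of \<open>S g\<close> is the upper limit of \<open>g\<close> along the sequence.\<close>
  define S :: "('v \<Rightarrow>\<^sub>L real) \<Rightarrow> real set"
    where "S = (\<lambda>g. {c. \<forall>\<^sub>F n in sequentially. g (x n) \<le> c})"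
  obtain n0 where "norm (x n0) \<le> C"
    using eventually_happens'[OF sequentially_bot bound] by blast
  then have C: "C \<ge> 0" using norm_ge_zero[of "x n0"] by linarith
  have abs: "\<forall>\<^sub>F n in sequentially. \<bar>g (x n)\<bar> \<le> C * norm g" for g :: "'v \<Rightarrow>\<^sub>L real"
    using bound
  proof eventually_elim
    case (elim n)
    have "\<bar>g (x n)\<bar> \<le> norm g * norm (x n)" using norm_blinfun[of g "x n"] by simp
    also have "\<dots> \<le> norm g * C" using elim by (intro mult_left_mono) auto
    finally show ?case by (simp add: mult.commute)
  qed
  have inS: "C * norm g \<in> S g" for g
    using abs[of g] unfolding S_def by (auto elim: eventually_mono)
  then have ne: "S g \<noteq> {}" for g by blast
  have bdd: "bdd_below (S g)" for g
  proof (rule bdd_belowI)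
    fix c assume "c \<in> S g"
    then have "\<forall>\<^sub>F n in sequentially. g (x n) \<le> c" by (simp add: S_def)
    with abs[of g] have "\<forall>\<^sub>F n in sequentially. - (C * norm g) \<le> c"
      by eventually_elim auto
    then show "- (C * norm g) \<le> c" by simp
  qed
  have le: "Inf (S g) \<le> c" if "c \<in> S g" for g c
    using that bdd by (rule cInf_lower)
  have sub: "sublinear (\<lambda>g. Inf (S g))"
    unfolding sublinear_def
  proof (intro conjI allI impI)
    fix g h
    show "Inf (S (g + h)) \<le> Inf (S g) + Inf (S h)"
    proof (rule le_Inf_add[OF ne ne])
      fix s t assume "s \<in> S g" "t \<in> S h"
      then have "\<forall>\<^sub>F n in sequentially. g (x n) \<le> s" "\<forall>\<^sub>F n in sequentially. h (x n) \<le> t"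
        by (simp_all add: S_def)
      then have "\<forall>\<^sub>F n in sequentially. (g + h) (x n) \<le> s + t"
        by eventually_elim (simp add: blinfun.add_left)
      then show "Inf (S (g + h)) \<le> s + t" by (intro le) (simp add: S_def)
    qed
  next
    fix r :: real and g assume r: "r > 0"
    show "Inf (S (r *\<^sub>R g)) \<le> r * Inf (S g)"
    proof (rule le_mult_Inf[OF ne r])
      fix s assume "s \<in> S g"
      then have "\<forall>\<^sub>F n in sequentially. g (x n) \<le> s" by (simp add: S_def)
      then have "\<forall>\<^sub>F n in sequentially. (r *\<^sub>R g) (x n) \<le> r * s"
        by eventually_elim (use r in \<open>simp add: blinfun.scaleR_left\<close>)
      then show "Inf (S (r *\<^sub>R g)) \<le> r * s" by (intro le) (simp add: S_def)
    qed
  qed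
  obtain \<Phi> :: "('v \<Rightarrow>\<^sub>L real) \<Rightarrow>\<^sub>L real"
    where \<Phi>: "\<And>g. \<Phi> g \<le> Inf (S g)" "\<Phi> f = Inf (S f)"
    using Hahn_Banach_blinfun[OF sub le[OF inS] C] by metis
  obtain l where l: "\<And>g. \<Phi> g = g l"
    using refl unfolding reflexive_space_def by metis
  show thesis
  proof (rule that)
    show "l \<in> asymptotic_hull x"
      unfolding asymptotic_hull_def
    proof (intro CollectI allI impI)
      fix g :: "'v \<Rightarrow>\<^sub>L real" and c
      assume "\<forall>\<^sub>F n in sequentially. g (x n) \<le> c"
      then have "Inf (S g) \<le> c" by (intro le) (simp add: S_def)
      with \<Phi>(1)[of g] l show "g l \<le> c" by simp
    qed
  next
    fix c assume "f l < c"
    then have "Inf (S f) < c" using \<Phi>(2) l by simp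
    then obtain s where "s \<in> S f" "s < c" using ne by (meson cInf_lessD)
    then show "\<forall>\<^sub>F n in sequentially. f (x n) < c"
      by (auto simp: S_def elim: eventually_mono)
  qed
qed

text \<open>For each $f$ the single point of the hull attains $\limsup f(x_n)$; for $-f$ it attains
  $-\liminf f(x_n)$.\<close>

lemma weakly_converges_unique_hull:
  fixes x :: "nat \<Rightarrow> 'v::real_normed_vector"
  assumes refl: "reflexive_space TYPE('v)"
    and bound: "\<forall>\<^sub>F n in sequentially. norm (x n) \<le> C"
    and unique: "\<And>m. m \<in> asymptotic_hull x \<Longrightarrow> m = l"
  shows "weakly_converges x l"
  unfolding weakly_converges_def
proof
  fix f :: "'v \<Rightarrow>\<^sub>L real"
  have upper: "\<forall>\<^sub>F n in sequentially. g (x n) < c" if "g l < c" for g :: "'v \<Rightarrow>\<^sub>L real" and c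
  proof -
    obtain m where "m \<in> asymptotic_hull x"
      "\<And>c. g m < c \<Longrightarrow> \<forall>\<^sub>F n in sequentially. g (x n) < c"
      using asymptotic_hull_attains_limsup[OF refl bound, of g] by blast
    with unique[of m] that show ?thesis by metis
  qed
  show "(\<lambda>n. f (x n)) \<longlonglongrightarrow> f l"
  proof (rule order_tendstoI)
    fix c assume "f l < c" then show "\<forall>\<^sub>F n in sequentially. f (x n) < c" by (rule upper)
  next
    fix c assume "c < f l"
    then show "\<forall>\<^sub>F n in sequentially. c < f (x n)"
      using upper[of "- f" "- c"] by (simp add: blinfun.minus_left)
  qed
qed

text \<open>Weak lower semicontinuity of the norm, tested with a norming functional of $l - a$.\<close>

lemma asymptotic_hull_norm_le:
  fixes x :: "nat \<Rightarrow> 'v::real_normed_vector"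
  assumes l: "l \<in> asymptotic_hull x" and le: "\<forall>\<^sub>F n in sequentially. norm (x n - a) \<le> c"
  shows "norm (l - a) \<le> c"
proof -
  obtain f :: "'v \<Rightarrow>\<^sub>L real" where f: "norm f \<le> 1" "f (l - a) = norm (l - a)"
    by (rule norming_functional)
  from le have "\<forall>\<^sub>F n in sequentially. f (x n) \<le> c + f a"
  proof eventually_elim
    case (elim n)
    then show ?case using blinfun_le_norm[OF f(1), of "x n - a"] by (simp add: blinfun.diff_right)
  qed
  then have "f l \<le> c + f a" by (rule asymptotic_hullD[OF l])
  with f show ?thesis by (simp add: blinfun.diff_right)
qed

lemma asymptotic_hull_norm_lsc:
  assumes l: "l \<in> asymptotic_hull x"
    and le: "\<And>e. e > 0 \<Longrightarrow> \<forall>\<^sub>F n in sequentially. norm (x n - a) \<le> r + e"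
  shows "norm (l - a) \<le> r"
proof (rule field_le_epsilon)
  fix e :: real assume "e > 0"
  then show "norm (l - a) \<le> r + e" using asymptotic_hull_norm_le[OF l le] by blast
qed

lemma asymptotic_hull_blinfun_image:
  assumes "l \<in> asymptotic_hull x"
  shows "blinfun_apply A l \<in> asymptotic_hull (\<lambda>n. blinfun_apply A (x n))"
  unfolding asymptotic_hull_def
proof (intro CollectI allI impI)
  fix f :: "'b \<Rightarrow>\<^sub>L real" and c
  assume "\<forall>\<^sub>F n in sequentially. f (A (x n)) \<le> c"
  then show "f (A l) \<le> c"
    using asymptotic_hullD[OF assms, of "f o\<^sub>L A" c] by simp
qed

text \<open>Closed subspaces are weakly closed: a functional that vanishes on $U$ and measures the distance
  of $l$ from $U$ is nonpositive at $l$.\<close>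

lemma asymptotic_hull_closed_subspace:
  fixes U :: "'v::real_normed_vector set"
  assumes l: "l \<in> asymptotic_hull x" and U: "subspace U" "closed U" and x: "\<And>n. x n \<in> U"
  shows "l \<in> U"
proof -
  obtain f :: "'v \<Rightarrow>\<^sub>L real" where f: "f \<in> annihilator U" "f l = infdist l U"
    using annihilating_functional[OF U(1)] by metis
  have "f l \<le> 0"
    using f(1) x by (intro asymptotic_hullD[OF l]) (simp add: annihilator_def)
  with f(2) have "infdist l U = 0" using infdist_nonneg[of l U] by simp
  moreover have "U \<noteq> {}" using x by blast
  ultimately show ?thesis using in_closed_iff_infdist_zero[OF U(2)] by blast
qed

text \<open>The convergence criterion behind both parts of the result. Points of the hull inherit the
  asymptotic bound on the distance from $a$, so the uniqueness hypothesis leaves only $l$ and the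
  convergence is weak. Together with weak lower semicontinuity the
  bound makes $\|x_n - a\|$ converge to $\|l - a\|$, and the Radon-Riesz property applies to $x_n - a$.\<close>

lemma radon_riesz_convergence:
  fixes x :: "nat \<Rightarrow> 'v::real_normed_vector"
  assumes refl: "reflexive_space TYPE('v)" and rr: "radon_riesz_space TYPE('v)"
    and upper: "\<And>e. e > 0 \<Longrightarrow> \<forall>\<^sub>F n in sequentially. norm (x n - a) \<le> norm (l - a) + e"
    and unique: "\<And>m. m \<in> asymptotic_hull x \<Longrightarrow> norm (m - a) \<le> norm (l - a) \<Longrightarrow> m = l"
  shows "x \<longlonglongrightarrow> l"
proof -
  let ?r = "norm (l - a)"
  have bound: "\<forall>\<^sub>F n in sequentially. norm (x n) \<le> ?r + 1 + norm a"
    using upper[of 1, simplified]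
  proof eventually_elim
    case (elim n)
    then show ?case using norm_triangle_sub[of "x n" a] by simp
  qed
  have weak: "weakly_converges x l"
    using asymptotic_hull_norm_lsc[OF _ upper] unique
    by (intro weakly_converges_unique_hull[OF refl bound]) blast
  then have "weakly_converges (\<lambda>n. x n - a) (l - a)"
    unfolding weakly_converges_def by (simp add: blinfun.diff_right tendsto_diff)
  moreover have "(\<lambda>n. norm (x n - a)) \<longlonglongrightarrow> ?r"
  proof (rule order_tendstoI)
    fix c assume "?r < c"
    then have "\<forall>\<^sub>F n in sequentially. norm (x n - a) \<le> ?r + (c - ?r) / 2" by (intro upper) simp
    then show "\<forall>\<^sub>F n in sequentially. norm (x n - a) < c"
      by eventually_elim (use \<open>?r < c\<close> in \<open>simp add: field_simps\<close>)
  next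
    fix c assume c: "c < ?r"
    obtain f :: "'v \<Rightarrow>\<^sub>L real" where f: "norm f \<le> 1" "f (l - a) = ?r"
      by (rule norming_functional)
    have "(\<lambda>n. f (x n - a)) \<longlonglongrightarrow> f (l - a)"
      using weak unfolding weakly_converges_def by (simp add: blinfun.diff_right tendsto_diff)
    then have "\<forall>\<^sub>F n in sequentially. c < f (x n - a)"
      using c f(2) by (intro order_tendstoD(1)) auto
    then show "\<forall>\<^sub>F n in sequentially. c < norm (x n - a)"
    proof eventually_elim
      case (elim n)
      then show ?case using blinfun_le_norm[OF f(1), of "x n - a"] by simp
    qed
  qed
  ultimately have "(\<lambda>n. norm ((x n - a) - (l - a))) \<longlonglongrightarrow> 0"
    using rr unfolding radon_riesz_space_def by blast
  then show ?thesis by (simp add: LIM_zero_iff tendsto_norm_zero_iff)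
qed

section \<open>Metric projections onto subspaces\<close>

lemma strictly_convex_midpoint:
  fixes x y :: "'v::real_normed_vector"
  assumes sc: "strictly_convex_space TYPE('v)" and eq: "norm x = norm y" and ne: "x \<noteq> y"
  shows "norm ((1/2) *\<^sub>R (x + y)) < norm x"
proof -
  have pos: "norm x > 0" using eq ne by auto
  let ?c = "1 / norm x"
  have "norm ((1/2) *\<^sub>R (?c *\<^sub>R x + ?c *\<^sub>R y)) < 1"
    using sc pos eq ne unfolding strictly_convex_space_def by auto
  also have "(1/2) *\<^sub>R (?c *\<^sub>R x + ?c *\<^sub>R y) = ?c *\<^sub>R ((1/2) *\<^sub>R (x + y))"
    by (simp add: algebra_simps)
  finally have "?c * norm ((1/2) *\<^sub>R (x + y)) < 1" using pos by (simp only: norm_scaleR) simp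
  then show ?thesis using pos by (simp add: field_simps)
qed

text \<open>Every point of the asymptotic hull of a minimizing sequence is a nearest point.\<close>

lemma nearest_point_exists:
  fixes U :: "'v::real_normed_vector set"
  assumes refl: "reflexive_space TYPE('v)" and U: "subspace U" "closed U"
  obtains u where "u \<in> U" "norm (y - u) = infdist y U"
proof -
  have ne: "U \<noteq> {}" using subspace_0[OF U(1)] by blast
  let ?d = "infdist y U"
  have "\<exists>u\<in>U. dist y u < ?d + 1 / Suc n" for n
    using cInf_lessD[of "dist y ` U" "?d + 1 / Suc n"] ne infdist_notempty[OF ne, of y] by force
  then obtain u where u: "\<And>n. u n \<in> U" "\<And>n. dist y (u n) < ?d + 1 / Suc n"
    by metis
  have upper: "\<forall>\<^sub>F n in sequentially. norm (u n - y) \<le> ?d + e" if "e > 0" for e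
  proof -
    have "(\<lambda>n. ?d + 1 / Suc n) \<longlonglongrightarrow> ?d + 0"
      by (intro tendsto_intros LIMSEQ_Suc[OF lim_1_over_n])
    then have "\<forall>\<^sub>F n in sequentially. ?d + 1 / Suc n < ?d + e"
      using that by (intro order_tendstoD(2)) auto
    then show ?thesis
    proof eventually_elim
      case (elim n)
      then show ?case using u(2)[of n] by (simp add: dist_norm norm_minus_commute)
    qed
  qed
  have "\<forall>\<^sub>F n in sequentially. norm (u n) \<le> ?d + 1 + norm y"
    using upper[OF zero_less_one]
  proof eventually_elim
    case (elim n)
    then show ?case using norm_triangle_sub[of "u n" y] by simp
  qed
  then obtain l where l: "l \<in> asymptotic_hull u"
    using asymptotic_hull_attains_limsup[OF refl, of u] by metis
  have "l \<in> U" using asymptotic_hull_closed_subspace[OF l U u(1)] .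
  moreover have "norm (l - y) \<le> ?d" using l upper by (rule asymptotic_hull_norm_lsc)
  ultimately show thesis
    using infdist_le[of l U y] by (intro that[of l]) (auto simp: dist_norm norm_minus_commute)
qed

lemma nearest_point_unique:
  fixes U :: "'v::real_normed_vector set"
  assumes sc: "strictly_convex_space TYPE('v)" and U: "subspace U"
    and u: "u \<in> U" "norm (y - u) \<le> infdist y U" and v: "v \<in> U" "norm (y - v) \<le> infdist y U"
  shows "u = v"
proof (rule ccontr)
  assume "u \<noteq> v"
  have eq: "norm (y - u) = infdist y U" "norm (y - v) = infdist y U"
    using u v infdist_le[of u U y] infdist_le[of v U y] by (auto simp: dist_norm)
  have "norm ((1/2) *\<^sub>R ((y - u) + (y - v))) < infdist y U"
    using strictly_convex_midpoint[OF sc, of "y - u" "y - v"] eq \<open>u \<noteq> v\<close> by auto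
  also have "(1/2) *\<^sub>R ((y - u) + (y - v)) = y - (1/2) *\<^sub>R (u + v)"
    by (simp add: algebra_simps flip: scaleR_add_left)
  finally have "dist y ((1/2) *\<^sub>R (u + v)) < infdist y U" by (simp add: dist_norm)
  moreover have "(1/2) *\<^sub>R (u + v) \<in> U"
    using U u v by (intro subspace_scale subspace_add) auto
  ultimately show False using infdist_le[of "(1/2) *\<^sub>R (u + v)" U y] by simp
qed

lemma metric_projection_eqI:
  fixes U :: "'v::real_normed_vector set"
  assumes sc: "strictly_convex_space TYPE('v)" and U: "subspace U"
    and u: "u \<in> U" "norm (y - u) \<le> infdist y U"
  shows "metric_projection U y = u"
proof -
  have inf: "(INF v\<in>U. norm (y - v)) = infdist y U"
    using u(1) by (subst infdist_notempty) (auto simp: dist_norm)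
  have "norm (y - u) = infdist y U" using u infdist_le[of u U y] by (simp add: dist_norm)
  then show ?thesis
    unfolding metric_projection_def inf
  proof (intro the_equality)
    fix w assume "w \<in> U \<and> norm (y - w) = infdist y U"
    then show "w = u" by (intro nearest_point_unique[OF sc U _ _ u]) auto
  qed (use u in auto)
qed

lemma metric_projection_nearest:
  fixes U :: "'v::real_normed_vector set"
  assumes "reflexive_space TYPE('v)" and sc: "strictly_convex_space TYPE('v)"
    and U: "subspace U" "closed U"
  shows "metric_projection U y \<in> U" "norm (y - metric_projection U y) = infdist y U"
proof -
  obtain u where "u \<in> U" "norm (y - u) = infdist y U"
    using nearest_point_exists[OF assms(1) U] by metis
  then show "metric_projection U y \<in> U" "norm (y - metric_projection U y) = infdist y U"
    using metric_projection_eqI[OF sc U(1)] by auto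
qed

text \<open>Both sides say that $x$ is orthogonal to $U$ in the sense of Birkhoff, i.e. that
  $\|x\| \le \|x - u\|$ for all $u \in U$. From left to right, a functional $f$ in the intersection
  gives $\|x\|^2 = f(x - u) \le \|x\| \|x - u\|$. Conversely the functional is $\|x\|$ times an
  annihilating functional that measures the distance of $x$ from $U$.\<close>

lemma duality_map_meets_annihilator_iff:
  fixes U :: "'v::real_normed_vector set"
  assumes U: "subspace U"
  shows "duality_map x \<inter> annihilator U \<noteq> {} \<longleftrightarrow> norm x = infdist x U"
proof
  assume "duality_map x \<inter> annihilator U \<noteq> {}"
  then obtain f :: "'v \<Rightarrow>\<^sub>L real" where "f \<in> duality_map x" "f \<in> annihilator U"
    by blast
  then have f: "f x = (norm x)\<^sup>2" "norm f = norm x" "\<And>u. u \<in> U \<Longrightarrow> f u = 0"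
    by (simp_all add: duality_map_def annihilator_def)
  have "norm x \<le> dist x u" if "u \<in> U" for u
  proof (cases "x = 0")
    case False
    have "norm x * norm x = f (x - u)"
      using f that by (simp add: blinfun.diff_right power2_eq_square)
    also have "\<dots> \<le> norm x * norm (x - u)" using f by (intro blinfun_le_norm) simp
    finally show ?thesis using False by (simp add: dist_norm)
  qed simp
  then have "norm x \<le> infdist x U"
    using subspace_0[OF U] by (auto simp: infdist_def intro: cINF_greatest)
  then show "norm x = infdist x U" using infdist_le[OF subspace_0[OF U], of x] by simp
next
  assume eq: "norm x = infdist x U"
  obtain g :: "'v \<Rightarrow>\<^sub>L real" where g: "g \<in> annihilator U" "g x = norm x" "norm g \<le> 1"
    using annihilating_functional[OF U] eq by metis
  define f where "f = norm x *\<^sub>R g"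
  have fx: "f x = norm x * norm x" using g by (simp add: f_def blinfun.scaleR_left)
  have "norm f \<le> norm x" using g(3) by (simp add: f_def mult_left_le)
  moreover have "norm x \<le> norm f"
    using fx blinfun_le_norm[OF order_refl, of f x] by (cases "x = 0") auto
  moreover have "f \<in> annihilator U"
    using g(1) by (simp add: f_def annihilator_def blinfun.scaleR_left)
  ultimately show "duality_map x \<inter> annihilator U \<noteq> {}"
    using fx by (auto simp: duality_map_def power2_eq_square)
qed

lemma infdist_add_subspace:
  fixes U :: "'v::real_normed_vector set"
  assumes U: "subspace U" and u: "u \<in> U"
  shows "infdist (u + x) U = infdist x U"
  using sublinear_add[OF sublinear_infdist[OF U], of u x]
    sublinear_add[OF sublinear_infdist[OF U], of "- u" "u + x"] u subspace_neg[OF U u]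
  by simp

lemma subspace_closure:
  fixes U :: "'v::real_normed_vector set"
  assumes U: "subspace U"
  shows "subspace (closure U)"
proof (rule subspaceI)
  show "0 \<in> closure U" using subspace_0[OF U] closure_subset by blast
next
  fix x y assume "x \<in> closure U" "y \<in> closure U"
  then obtain a b where "\<And>n. a n \<in> U" "a \<longlonglongrightarrow> x" "\<And>n. b n \<in> U" "b \<longlonglongrightarrow> y"
    unfolding closure_sequential by blast
  then show "x + y \<in> closure U"
    unfolding closure_sequential
    by (intro exI[of _ "\<lambda>n. a n + b n"]) (auto intro: tendsto_add subspace_add[OF U])
next
  fix c x assume "x \<in> closure U"
  then obtain a where "\<And>n. a n \<in> U" "a \<longlonglongrightarrow> x"
    unfolding closure_sequential by blast
  then show "c *\<^sub>R x \<in> closure U"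
    unfolding closure_sequential
    by (intro exI[of _ "\<lambda>n. c *\<^sub>R a n"]) (auto intro: tendsto_scaleR subspace_scale[OF U])
qed

lemma infdist_closure: "infdist x (closure U) = infdist x U"
  by (simp add: infdist_eq_setdist)

lemma subspace_null_space: "subspace (null_space A)"
  by (auto simp: null_space_def subspace_def blinfun.add_right blinfun.scaleR_right)

lemma closed_null_space: "closed (null_space A)"
proof -
  have "null_space A = blinfun_apply A -` {0}" by (auto simp: null_space_def)
  moreover have "closed (blinfun_apply A -` {0})"
    by (intro closed_vimage closed_singleton linear_continuous_on blinfun.bounded_linear_right)
  ultimately show ?thesis by simp
qed

lemma subspace_range_blinfun: "subspace (range (blinfun_apply A))"
  by (simp add: blinfun.bounded_linear_right bounded_linear.linear linear_subspace_image)

section \<open>The metric generalized inverse\<close>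

lemma C_dom_iff: "x \<in> C_dom A \<longleftrightarrow> norm x = infdist x (null_space A)"
  by (simp add: C_dom_def duality_map_meets_annihilator_iff subspace_null_space)

lemma C_cod_iff: "y \<in> C_cod A \<longleftrightarrow> norm y = infdist y (range (blinfun_apply A))"
  by (simp add: C_cod_def duality_map_meets_annihilator_iff subspace_range_blinfun)

text \<open>Elements with the same image differ by an element of the null space, and $0$ is the only point of
  the null space nearest to $z$.\<close>

lemma C_dom_norm_minimal:
  fixes A :: "'a::real_normed_vector \<Rightarrow>\<^sub>L 'b::real_normed_vector"
  assumes sc: "strictly_convex_space TYPE('a)" and z: "z \<in> C_dom A" and eq: "A x = A z"
  shows "norm z \<le> norm x" "norm x \<le> norm z \<Longrightarrow> x = z"
proof -
  have n: "z - x \<in> null_space A" using eq by (simp add: null_space_def blinfun.diff_right)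
  have z': "norm z = infdist z (null_space A)" using z C_dom_iff by blast
  then show "norm z \<le> norm x" using infdist_le[OF n, of z] by (simp add: dist_norm)
  assume "norm x \<le> norm z"
  then have "z - x = 0"
    using z' n by (intro nearest_point_unique[OF sc subspace_null_space[of A], of _ z])
      (auto intro: subspace_0 subspace_null_space)
  then show "x = z" by simp
qed

text \<open>Subtracting from $x$ its nearest point in the null space produces the representative.\<close>

lemma C_dom_solution_exists:
  fixes A :: "'a::real_normed_vector \<Rightarrow>\<^sub>L 'b::real_normed_vector"
  assumes "reflexive_space TYPE('a)"
  obtains z where "z \<in> C_dom A" "A z = A x"
proof -
  obtain n where n: "n \<in> null_space A" "norm (x - n) = infdist x (null_space A)"
    using nearest_point_exists[OF assms subspace_null_space closed_null_space] by metis
  have "infdist (x - n) (null_space A) = infdist x (null_space A)"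
    using infdist_add_subspace[OF subspace_null_space, of "- n" A x] n(1)
      subspace_neg[OF subspace_null_space] by force
  with n(2) have "x - n \<in> C_dom A" by (simp add: C_dom_iff)
  moreover have "A (x - n) = A x" using n(1) by (simp add: null_space_def blinfun.diff_right)
  ultimately show thesis by (rule that)
qed

lemma range_projection_eqI:
  fixes A :: "'a::real_normed_vector \<Rightarrow>\<^sub>L 'b::real_normed_vector"
  assumes "strictly_convex_space TYPE('b)"
    and "u \<in> closure (range (blinfun_apply A))"
    and "norm (y - u) \<le> infdist y (range (blinfun_apply A))"
  shows "range_projection A y = u"
  unfolding range_projection_def
  using assms by (intro metric_projection_eqI subspace_closure subspace_range_blinfun)
    (auto simp: infdist_closure)

lemma range_projection_nearest:
  fixes A :: "'a::real_normed_vector \<Rightarrow>\<^sub>L 'b::real_normed_vector"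
  assumes "reflexive_space TYPE('b)" "strictly_convex_space TYPE('b)"
  shows "norm (y - range_projection A y) = infdist y (range (blinfun_apply A))"
  unfolding range_projection_def
  using metric_projection_nearest(2)[OF assms subspace_closure[OF subspace_range_blinfun] closed_closure]
  by (simp add: infdist_closure)

text \<open>For $y = r + c$ with $r$ in the range and $c$ orthogonal to it, $r$ is the nearest point.\<close>

lemma range_projection_in_range:
  fixes A :: "'a::real_normed_vector \<Rightarrow>\<^sub>L 'b::real_normed_vector"
  assumes sc: "strictly_convex_space TYPE('b)" and y: "y \<in> metric_ginv_domain A"
  shows "range_projection A y \<in> range (blinfun_apply A)"
proof -
  obtain r c where rc: "y = r + c" "r \<in> range (blinfun_apply A)" "c \<in> C_cod A"
    using y by (auto simp: metric_ginv_domain_def)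
  have "norm (y - r) = infdist y (range (blinfun_apply A))"
    using rc infdist_add_subspace[OF subspace_range_blinfun rc(2), of c] by (simp add: C_cod_iff)
  then have "range_projection A y = r"
    using rc(2) by (intro range_projection_eqI[OF sc] subsetD[OF closure_subset]) auto
  with rc(2) show ?thesis by simp
qed

lemma metric_ginv_solution:
  fixes A :: "'a::real_normed_vector \<Rightarrow>\<^sub>L 'b::real_normed_vector"
  assumes X: "reflexive_space TYPE('a)" "strictly_convex_space TYPE('a)"
    and Y: "strictly_convex_space TYPE('b)" and y: "y \<in> metric_ginv_domain A"
  shows "metric_ginv A y \<in> C_dom A" "A (metric_ginv A y) = range_projection A y"
proof -
  obtain x where "range_projection A y = A x"
    using range_projection_in_range[OF Y y] by blast
  then obtain z where z: "z \<in> C_dom A" "A z = range_projection A y"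
    using C_dom_solution_exists[OF X(1), of A x] by metis
  have inj: "inj_on (blinfun_apply A) (C_dom A)"
  proof (rule inj_onI)
    fix u v assume "u \<in> C_dom A" "v \<in> C_dom A" "A u = A v"
    then show "u = v"
      using C_dom_norm_minimal(1)[OF X(2), of u A v] C_dom_norm_minimal(2)[OF X(2), of v A u] by simp
  qed
  have "metric_ginv A y = z"
    unfolding metric_ginv_def using z the_inv_into_f_f[OF inj z(1)] by simp
  with z show "metric_ginv A y \<in> C_dom A" "A (metric_ginv A y) = range_projection A y" by auto
qed

lemma best_approx_solution_iff:
  fixes A :: "'a::real_normed_vector \<Rightarrow>\<^sub>L 'b::real_normed_vector"
  assumes Y: "reflexive_space TYPE('b)" "strictly_convex_space TYPE('b)"
    and y: "y \<in> metric_ginv_domain A"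
  shows "best_approx_solution A y x \<longleftrightarrow> A x = range_projection A y"
proof
  assume best: "best_approx_solution A y x"
  obtain z where z: "range_projection A y = A z"
    using range_projection_in_range[OF Y(2) y] by blast
  have "norm (A x - y) \<le> norm (A z - y)"
    using best by (simp add: best_approx_solution_def is_arg_min_linorder)
  also have "\<dots> = infdist y (range (blinfun_apply A))"
    using range_projection_nearest[OF Y, of y A] z by (simp add: norm_minus_commute)
  finally have "norm (y - A x) \<le> infdist y (range (blinfun_apply A))"
    by (simp add: norm_minus_commute)
  then have "range_projection A y = A x"
    by (intro range_projection_eqI[OF Y(2)] subsetD[OF closure_subset]) auto
  then show "A x = range_projection A y" by simp
next
  assume "A x = range_projection A y"
  then have "norm (A x - y) \<le> norm (A x' - y)" for x'
    using range_projection_nearest[OF Y, of y A] infdist_le[of "A x'" "range (blinfun_apply A)" y]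
    by (simp add: dist_norm norm_minus_commute)
  then show "best_approx_solution A y x"
    by (simp add: best_approx_solution_def is_arg_min_linorder)
qed

lemma min_norm_solution_iff:
  fixes A :: "'a::real_normed_vector \<Rightarrow>\<^sub>L 'b::real_normed_vector"
  assumes X: "reflexive_space TYPE('a)" "strictly_convex_space TYPE('a)"
    and Y: "reflexive_space TYPE('b)" "strictly_convex_space TYPE('b)"
    and y: "y \<in> metric_ginv_domain A"
  shows "min_norm_solution A y x \<longleftrightarrow> x = metric_ginv A y"
proof -
  note z = metric_ginv_solution[OF X Y(2) y]
  note best = best_approx_solution_iff[OF Y y]
  note minimal = C_dom_norm_minimal[OF X(2) z(1)]
  show ?thesis
    unfolding min_norm_solution_def is_arg_min_linorder best
    using z(2) minimal by metis
qed

section \<open>Existence and uniqueness of Tikhonov minimizers\<close>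

text \<open>Strict midpoint convexity of $x \mapsto x^q$ on $[0, \infty)$, including the endpoint $0$, where the
  derivative is not at hand: by the mean value theorem the increments over the two halves of the
  interval are governed by the derivative at interior points, and the derivative increases.\<close>

lemma powr_midpoint_less:
  fixes a b q :: real
  assumes "0 \<le> a" "0 \<le> b" "a \<noteq> b" "q > 1"
  shows "((a + b) / 2) powr q < (a powr q + b powr q) / 2"
proof -
  have *: "((a + b) / 2) powr q < (a powr q + b powr q) / 2" if ab: "0 \<le> a" "a < b" for a b
  proof -
    let ?m = "(a + b) / 2"
    let ?f = "\<lambda>x::real. x powr q"
    have der: "(?f has_real_derivative q * x powr (q - 1)) (at x)" if "x > 0" for x
      using that by (rule has_real_derivative_powr)
    have cont: "continuous_on {c..d} ?f" if "c \<ge> 0" for c d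
      using \<open>q > 1\<close> that by (intro continuous_on_powr' continuous_intros) auto
    have mean: "\<exists>z. c < z \<and> z < d \<and> ?f d - ?f c = (d - c) * (q * z powr (q - 1))"
      if cd: "0 \<le> c" "c < d" for c d
    proof -
      obtain l z where z: "c < z" "z < d" "(?f has_real_derivative l) (at z)"
        "?f d - ?f c = (d - c) * l"
        using MVT[OF cd(2) cont[OF cd(1)]] der cd(1)
        by (metis order.strict_trans1 real_differentiable_def)
      have "l = q * z powr (q - 1)" using z(1) cd by (intro DERIV_unique[OF z(3) der]) auto
      with z show ?thesis by blast
    qed
    obtain u where u: "a < u" "u < ?m" "?f ?m - ?f a = (?m - a) * (q * u powr (q - 1))"
      using mean[of a ?m] ab by auto
    obtain v where v: "?m < v" "v < b" "?f b - ?f ?m = (b - ?m) * (q * v powr (q - 1))"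
      using mean[of ?m b] ab by auto
    have "u powr (q - 1) < v powr (q - 1)"
      using u v ab \<open>q > 1\<close> by (intro powr_less_mono2) auto
    then have less: "(?m - a) * (q * u powr (q - 1)) < (?m - a) * (q * v powr (q - 1))"
      using ab \<open>q > 1\<close> by (intro mult_strict_left_mono) auto
    have eq: "b - ?m = ?m - a" by (simp add: field_simps)
    have "?f ?m - ?f a < ?f b - ?f ?m"
      unfolding u(3) v(3) using less by (simp only: eq)
    then show ?thesis by simp
  qed
  show ?thesis
    using *[of a b] *[of b a] assms by (cases "a < b") (auto simp: add.commute)
qed

lemma norm_powr_midpoint_le:
  fixes x y :: "'v::real_normed_vector"
  assumes "q \<ge> 1"
  shows "norm ((1/2) *\<^sub>R (x + y)) powr q \<le> (norm x powr q + norm y powr q) / 2"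
proof -
  have "norm ((1/2) *\<^sub>R (x + y)) \<le> (norm x + norm y) / 2"
    using norm_triangle_ineq[of x y] by simp
  then have "norm ((1/2) *\<^sub>R (x + y)) powr q \<le> ((norm x + norm y) / 2) powr q"
    using assms by (intro powr_mono2) auto
  also have "\<dots> \<le> (norm x powr q + norm y powr q) / 2"
    using powr_midpoint_less[of "norm x" "norm y" q] assms
    by (cases "q = 1"; cases "norm x = norm y") auto
  finally show ?thesis .
qed

lemma norm_powr_midpoint_less:
  fixes x y :: "'v::real_normed_vector"
  assumes sc: "strictly_convex_space TYPE('v)" and q: "q \<ge> 1" and ne: "x \<noteq> y"
    and "q > 1 \<or> norm x = norm y"
  shows "norm ((1/2) *\<^sub>R (x + y)) powr q < (norm x powr q + norm y powr q) / 2"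
proof (cases "norm x = norm y")
  case True
  have "norm ((1/2) *\<^sub>R (x + y)) powr q < norm x powr q"
    using strictly_convex_midpoint[OF sc True ne] q by (intro powr_less_mono2) auto
  with True show ?thesis by simp
next
  case False
  with assms have "q > 1" by blast
  have "norm ((1/2) *\<^sub>R (x + y)) \<le> (norm x + norm y) / 2"
    using norm_triangle_ineq[of x y] by simp
  then have "norm ((1/2) *\<^sub>R (x + y)) powr q \<le> ((norm x + norm y) / 2) powr q"
    using q by (intro powr_mono2) auto
  also have "\<dots> < (norm x powr q + norm y powr q) / 2"
    using False \<open>q > 1\<close> by (intro powr_midpoint_less) auto
  finally show ?thesis .
qed

lemma tikhonov_minimizer_le: "tikhonov_minimizer p q A \<alpha> y x \<Longrightarrow> tikhonov p q A \<alpha> x y \<le> tikhonov p q A \<alpha> x' y"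
  by (simp add: tikhonov_minimizer_def is_arg_min_linorder)

text \<open>At the midpoint of two minimizers one of the two terms of the functional is strictly smaller than
  the average. For $q > 1$ this is the penalty. For $p > 1$ it is the residual unless the images
  agree; if they do, then the norms agree as well, and strict convexity of the space lowers the norm
  at the midpoint whatever $q$ is.\<close>

lemma tikhonov_minimizer_unique:
  fixes A :: "'a::real_normed_vector \<Rightarrow>\<^sub>L 'b::real_normed_vector"
  assumes X: "strictly_convex_space TYPE('a)" and Y: "strictly_convex_space TYPE('b)"
    and pq: "p \<ge> 1" "q \<ge> 1" "p > 1 \<or> q > 1" and \<alpha>: "\<alpha> > 0"
    and x: "tikhonov_minimizer p q A \<alpha> y x" and x': "tikhonov_minimizer p q A \<alpha> y x'"
  shows "x = x'"
proof (rule ccontr)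
  assume ne: "x \<noteq> x'"
  define m where "m = (1/2) *\<^sub>R (x + x')"
  let ?R = "\<lambda>x. norm (A x - y) powr p" and ?N = "\<lambda>x :: 'a. norm x powr q"
  have Am: "A m - y = (1/2) *\<^sub>R ((A x - y) + (A x' - y))"
    by (simp add: m_def blinfun.add_right blinfun.scaleR_right algebra_simps flip: scaleR_add_left)
  have T: "?R x + \<alpha> * ?N x \<le> ?R z + \<alpha> * ?N z" "?R x' + \<alpha> * ?N x' \<le> ?R z + \<alpha> * ?N z" for z
    using tikhonov_minimizer_le[OF x, of z] tikhonov_minimizer_le[OF x', of z]
    by (simp_all add: tikhonov_def)
  have R: "?R m \<le> (?R x + ?R x') / 2"
    unfolding Am using pq by (intro norm_powr_midpoint_le) auto
  have N: "?N m \<le> (?N x + ?N x') / 2"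
    unfolding m_def using pq by (intro norm_powr_midpoint_le) auto
  have "?R m < (?R x + ?R x') / 2 \<or> ?N m < (?N x + ?N x') / 2"
  proof (cases "q > 1")
    case True
    then show ?thesis
      unfolding m_def using norm_powr_midpoint_less[OF X pq(2) ne] by blast
  next
    case False
    with pq have p: "p > 1" by blast
    show ?thesis
    proof (cases "A x = A x'")
      case True
      then have "\<alpha> * ?N x \<le> \<alpha> * ?N x'" "\<alpha> * ?N x' \<le> \<alpha> * ?N x"
        using T(1)[of x'] T(2)[of x] by simp_all
      then have eq: "?N x = ?N x'" using \<alpha> by simp
      have "norm x = norm x'"
      proof (rule linorder_cases[of "norm x" "norm x'"])
        assume "norm x < norm x'"
        then show ?thesis using powr_less_mono2[of q "norm x" "norm x'"] eq pq by simp
      next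
        assume "norm x' < norm x"
        then show ?thesis using powr_less_mono2[of q "norm x'" "norm x"] eq pq by simp
      qed
      then show ?thesis
        unfolding m_def using norm_powr_midpoint_less[OF X pq(2) ne] by blast
    next
      case False
      then show ?thesis
        unfolding Am using norm_powr_midpoint_less[OF Y pq(1), of "A x - y" "A x' - y"] p by simp
    qed
  qed
  then have "?R m + \<alpha> * ?N m < (?R x + ?R x') / 2 + \<alpha> * ((?N x + ?N x') / 2)"
  proof
    assume "?R m < (?R x + ?R x') / 2"
    then show ?thesis using N \<alpha> by (intro add_less_le_mono mult_left_mono) auto
  next
    assume "?N m < (?N x + ?N x') / 2"
    then show ?thesis using R \<alpha> by (intro add_le_less_mono mult_strict_left_mono) auto
  qed
  also have "\<dots> = ((?R x + \<alpha> * ?N x) + (?R x' + \<alpha> * ?N x')) / 2" by (simp add: field_simps)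
  also have "\<dots> \<le> ?R m + \<alpha> * ?N m" using T(1)[of m] T(2)[of m] by simp
  finally show False by simp
qed

text \<open>A minimizing sequence is bounded because of the penalty term. Along a subsequence the residual norm and
  the norm converge separately, and a point of the asymptotic hull of this subsequence lies below
  both limits.\<close>

lemma tikhonov_minimizer_exists:
  fixes A :: "'a::real_normed_vector \<Rightarrow>\<^sub>L 'b::real_normed_vector"
  assumes refl: "reflexive_space TYPE('a)" and pq: "p > 0" "q > 0" and \<alpha>: "\<alpha> > 0"
  obtains x where "tikhonov_minimizer p q A \<alpha> y x"
proof -
  let ?T = "\<lambda>x. tikhonov p q A \<alpha> x y"
  have nonneg: "?T x \<ge> 0" for x using \<alpha> by (simp add: tikhonov_def)
  define t where "t = Inf (range ?T)"
  have le: "t \<le> ?T x" for x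
    unfolding t_def using nonneg by (intro cInf_lower bdd_belowI[of _ 0]) auto
  have "\<exists>x. ?T x < t + 1 / Suc n" for n
    using cInf_lessD[of "range ?T" "t + 1 / Suc n"] unfolding t_def by force
  then obtain x where x: "\<And>n. ?T (x n) < t + 1 / Suc n" by metis
  have lim: "(\<lambda>n. ?T (x n)) \<longlonglongrightarrow> t"
  proof (rule tendsto_sandwich[OF _ _ tendsto_const])
    have "(\<lambda>n. t + 1 / Suc n) \<longlonglongrightarrow> t + 0"
      by (intro tendsto_intros LIMSEQ_Suc[OF lim_1_over_n])
    then show "(\<lambda>n. t + 1 / Suc n) \<longlonglongrightarrow> t" by simp
    show "\<forall>\<^sub>F n in sequentially. ?T (x n) \<le> t + 1 / Suc n"
      using x by (intro always_eventually allI less_imp_le)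
  qed (use le in simp)
  \<comment> \<open>Solves \<open>\<alpha> * K powr q = t + 1\<close>, so the penalty keeps the sequence in the ball of radius \<open>K\<close>.\<close>
  define K where "K = ((t + 1) / \<alpha>) powr (1 / q)"
  have normx: "norm (x n) \<le> K" for n
  proof -
    have "\<alpha> * norm (x n) powr q \<le> ?T (x n)" by (simp add: tikhonov_def)
    also have "\<dots> \<le> t + 1" using x[of n] by (smt (verit) divide_le_eq_1 of_nat_0_le_iff of_nat_Suc)
    finally have "norm (x n) powr q \<le> (t + 1) / \<alpha>" using \<alpha> by (simp add: field_simps)
    then have "(norm (x n) powr q) powr (1 / q) \<le> K"
      unfolding K_def using pq by (intro powr_mono2) auto
    then show ?thesis using pq by (simp add: powr_powr)
  qed
  have normAx: "norm (A (x n) - y) \<le> norm A * K + norm y" for n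
  proof -
    have "norm (A (x n) - y) \<le> norm (A (x n)) + norm y" by (rule norm_triangle_ineq4)
    also have "norm (A (x n)) \<le> norm A * norm (x n)" by (rule norm_blinfun)
    also have "\<dots> \<le> norm A * K" using normx by (intro mult_left_mono) auto
    finally show ?thesis by simp
  qed
  have "bounded (range (\<lambda>n. (norm (A (x n) - y), norm (x n))))"
  proof (rule bounded_subset)
    show "bounded ({0..norm A * K + norm y} \<times> {0..K})" by (intro bounded_Times) auto
  qed (use normx normAx in auto)
  then obtain l r where r: "strict_mono (r :: nat \<Rightarrow> nat)"
    and l: "((\<lambda>n. (norm (A (x n) - y), norm (x n))) \<circ> r) \<longlonglongrightarrow> l"
    using bounded_imp_convergent_subsequence by blast
  obtain a b where ab: "l = (a, b)" by fastforce
  have a: "(\<lambda>n. norm (A (x (r n)) - y)) \<longlonglongrightarrow> a" and b: "(\<lambda>n. norm (x (r n))) \<longlonglongrightarrow> b"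
    using tendsto_fst[OF l] tendsto_snd[OF l] by (simp_all add: ab)
  have "(\<lambda>n. ?T (x (r n))) \<longlonglongrightarrow> a powr p + \<alpha> * b powr q"
    unfolding tikhonov_def using a b pq by (intro tendsto_intros tendsto_powr') auto
  moreover have "(\<lambda>n. ?T (x (r n))) \<longlonglongrightarrow> t"
    using LIMSEQ_subseq_LIMSEQ[OF lim r] by (simp add: o_def)
  ultimately have t: "t = a powr p + \<alpha> * b powr q" by (intro LIMSEQ_unique)
  have below: "\<forall>\<^sub>F n in sequentially. s n \<le> c + e" if "s \<longlonglongrightarrow> c" "e > 0"
    for s :: "nat \<Rightarrow> real" and c e
    using order_tendstoD(2)[OF that(1), of "c + e"] that(2) by (auto elim: eventually_mono)
  have "\<forall>\<^sub>F n in sequentially. norm (x (r n)) \<le> K" using normx by simp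
  then obtain m where m: "m \<in> asymptotic_hull (\<lambda>n. x (r n))"
    using asymptotic_hull_attains_limsup[OF refl, of "\<lambda>n. x (r n)" K] by metis
  have "norm (m - 0) \<le> b"
    using below[OF b] by (intro asymptotic_hull_norm_lsc[OF m]) simp
  moreover have "norm (A m - y) \<le> a"
    using below[OF a] by (intro asymptotic_hull_norm_lsc[OF asymptotic_hull_blinfun_image[OF m]])
  ultimately have "?T m \<le> t"
    unfolding t tikhonov_def using pq \<alpha> by (intro add_mono mult_left_mono powr_mono2) auto
  then have "?T m \<le> ?T z" for z using le by (rule order_trans)
  then show thesis by (intro that[of m]) (simp add: tikhonov_minimizer_def is_arg_min_linorder)
qed

section \<open>Convergence for vanishing regularization parameter\<close>

text \<open>A competitor with no larger residual must pay at least as much penalty.\<close>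

lemma tikhonov_minimizer_norm_le:
  assumes min: "tikhonov_minimizer p q A \<alpha> y x" and pq: "p > 0" "q > 0" and \<alpha>: "\<alpha> > 0"
    and z: "norm (blinfun_apply A z - y) \<le> norm (blinfun_apply A x - y)"
  shows "norm x \<le> norm z"
proof (rule ccontr)
  assume "\<not> norm x \<le> norm z"
  then have "norm z powr q < norm x powr q" using pq by (intro powr_less_mono2) auto
  moreover have "norm (A z - y) powr p \<le> norm (A x - y) powr p"
    using z pq by (intro powr_mono2) auto
  ultimately have "tikhonov p q A \<alpha> z y < tikhonov p q A \<alpha> x y"
    unfolding tikhonov_def using \<alpha> by (intro add_le_less_mono mult_strict_left_mono)
  with tikhonov_minimizer_le[OF min, of z] show False by simp
qed

text \<open>Choose $z$ with residual below $d + e$, where $d$ is the distance of $y$ from the range. Its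
  penalty is multiplied by $\alpha_n$ and vanishes in the limit.\<close>

lemma tikhonov_residual_upper:
  assumes min: "\<And>n. tikhonov_minimizer p q A (\<alpha> n) y (x n)" and pq: "p > 0" "q > 0"
    and \<alpha>: "\<And>n. \<alpha> n > 0" "\<alpha> \<longlonglongrightarrow> 0" and e: "e > 0"
  shows "\<forall>\<^sub>F n in sequentially.
    norm (blinfun_apply A (x n) - y) \<le> infdist y (range (blinfun_apply A)) + e"
proof -
  let ?d = "infdist y (range (blinfun_apply A))"
  obtain z where z: "norm (A z - y) < ?d + e"
    using cInf_lessD[of "dist y ` range (blinfun_apply A)" "?d + e"] e
      infdist_notempty[of "range (blinfun_apply A)" y]
    by (auto simp: dist_norm norm_minus_commute)
  have "(\<lambda>n. norm (A z - y) powr p + \<alpha> n * norm z powr q)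
      \<longlonglongrightarrow> norm (A z - y) powr p + 0 * norm z powr q"
    by (intro tendsto_intros \<alpha>(2))
  moreover have "norm (A z - y) powr p + 0 * norm z powr q < (?d + e) powr p"
    using z pq by (simp add: powr_less_mono2)
  ultimately have "\<forall>\<^sub>F n in sequentially.
      norm (A z - y) powr p + \<alpha> n * norm z powr q < (?d + e) powr p"
    by (rule order_tendstoD(2))
  then show ?thesis
  proof eventually_elim
    case (elim n)
    have "norm (A (x n) - y) powr p \<le> tikhonov p q A (\<alpha> n) (x n) y"
      using \<alpha>(1)[of n] by (simp add: tikhonov_def)
    also have "\<dots> \<le> tikhonov p q A (\<alpha> n) z y" by (rule tikhonov_minimizer_le[OF min])
    finally have "norm (A (x n) - y) powr p < (?d + e) powr p"
      using elim by (simp add: tikhonov_def)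
    then show ?case
      using powr_mono2[of p "?d + e" "norm (A (x n) - y)"] pq infdist_nonneg[of y "range (blinfun_apply A)"] e
      by linarith
  qed
qed

text \<open>The only point of the closure of the range within distance $d$ of $y$ is the projection of $y$.\<close>

lemma tikhonov_residual_convergence:
  fixes A :: "'a::real_normed_vector \<Rightarrow>\<^sub>L 'b::real_normed_vector"
  assumes Y: "reflexive_space TYPE('b)" "strictly_convex_space TYPE('b)" "radon_riesz_space TYPE('b)"
    and min: "\<And>n. tikhonov_minimizer p q A (\<alpha> n) y (x n)" and pq: "p > 0" "q > 0"
    and \<alpha>: "\<And>n. \<alpha> n > 0" "\<alpha> \<longlonglongrightarrow> 0"
  shows "(\<lambda>n. A (x n)) \<longlonglongrightarrow> range_projection A y"
proof (rule radon_riesz_convergence[OF Y(1,3)])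
  have dist: "norm (range_projection A y - y) = infdist y (range (blinfun_apply A))"
    using range_projection_nearest[OF Y(1,2), of y A] by (simp add: norm_minus_commute)
  show "\<forall>\<^sub>F n in sequentially. norm (A (x n) - y) \<le> norm (range_projection A y - y) + e"
    if "e > 0" for e
    unfolding dist using tikhonov_residual_upper[OF min pq \<alpha> that] .
  fix m assume m: "m \<in> asymptotic_hull (\<lambda>n. A (x n))"
    "norm (m - y) \<le> norm (range_projection A y - y)"
  have "m \<in> closure (range (blinfun_apply A))"
    by (intro asymptotic_hull_closed_subspace[OF m(1)] subspace_closure subspace_range_blinfun
        subsetD[OF closure_subset]) auto
  then show "m = range_projection A y"
    using m(2) range_projection_eqI[OF Y(2), of m A y]
    unfolding dist by (simp add: norm_minus_commute)
qed

text \<open>A point $m$ of the asymptotic hull satisfies $\|A m - y\| \le d$, so $m$ solves the same equation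
  as the minimum norm solution, whose norm it does not exceed.\<close>

lemma tikhonov_convergence:
  fixes A :: "'a::real_normed_vector \<Rightarrow>\<^sub>L 'b::real_normed_vector"
  assumes X: "reflexive_space TYPE('a)" "strictly_convex_space TYPE('a)" "radon_riesz_space TYPE('a)"
    and Y: "reflexive_space TYPE('b)" "strictly_convex_space TYPE('b)"
    and y: "y \<in> metric_ginv_domain A"
    and min: "\<And>n. tikhonov_minimizer p q A (\<alpha> n) y (x n)" and pq: "p > 0" "q > 0"
    and \<alpha>: "\<And>n. \<alpha> n > 0" "\<alpha> \<longlonglongrightarrow> 0"
  shows "x \<longlonglongrightarrow> metric_ginv A y"
proof (rule radon_riesz_convergence[OF X(1,3), where a = 0])
  let ?z = "metric_ginv A y"
  note z = metric_ginv_solution[OF X(1,2) Y(2) y]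
  have best: "norm (A ?z - y) \<le> norm (A (x n) - y)" for n
    using best_approx_solution_iff[OF Y y, of ?z] z(2)
    by (simp add: best_approx_solution_def is_arg_min_linorder)
  show "\<forall>\<^sub>F n in sequentially. norm (x n - 0) \<le> norm (?z - 0) + e" if "e > 0" for e
    using tikhonov_minimizer_norm_le[OF min pq \<alpha>(1) best] that
    by (intro always_eventually allI) (simp add: add_increasing2)
  fix m assume m: "m \<in> asymptotic_hull x" "norm (m - 0) \<le> norm (?z - 0)"
  have "norm (A m - y) \<le> infdist y (range (blinfun_apply A))"
    using asymptotic_hull_blinfun_image[OF m(1)] tikhonov_residual_upper[OF min pq \<alpha>]
    by (rule asymptotic_hull_norm_lsc)
  then have "A m = A ?z"
    using z(2) range_projection_eqI[OF Y(2) subsetD[OF closure_subset rangeI], of y A m]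
    by (simp add: norm_minus_commute)
  then show "m = ?z" using C_dom_norm_minimal(2)[OF X(2) z(1)] m(2) by simp
qed

lemma tendsto_at_right_0_sequentiallyI:
  fixes f :: "real \<Rightarrow> 'c::topological_space"
  assumes "\<And>\<alpha>. (\<And>n. \<alpha> n > 0) \<Longrightarrow> \<alpha> \<longlonglongrightarrow> 0 \<Longrightarrow> (\<lambda>n. f (\<alpha> n)) \<longlonglongrightarrow> l"
  shows "(f \<longlongrightarrow> l) (at_right 0)"
  unfolding tendsto_at_iff_sequentially o_def using assms by auto

theorem theorem4:
  fixes A :: "'a::banach \<Rightarrow>\<^sub>L 'b::banach" and p q :: real
  assumes "reflexive_space TYPE('a)" "strictly_convex_space TYPE('a)" "radon_riesz_space TYPE('a)"
    and "reflexive_space TYPE('b)" "strictly_convex_space TYPE('b)" "radon_riesz_space TYPE('b)"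
    and "p \<ge> 1" "q \<ge> 1"
  shows
    "(\<forall>\<alpha>>0. \<forall>y. \<exists>x. tikhonov_minimizer p q A \<alpha> y x) \<and>
     (p > 1 \<or> q > 1 \<longrightarrow> (\<forall>\<alpha>>0. \<forall>y. \<exists>!x. tikhonov_minimizer p q A \<alpha> y x)) \<and>
     (\<forall>x :: real \<Rightarrow> 'b \<Rightarrow> 'a. (\<forall>\<alpha>>0. \<forall>y. tikhonov_minimizer p q A \<alpha> y (x \<alpha> y)) \<longrightarrow>
        (\<forall>y\<in>metric_ginv_domain A.
           (\<exists>!z. min_norm_solution A y z) \<and>
           min_norm_solution A y (metric_ginv A y) \<and>
           ((\<lambda>\<alpha>. x \<alpha> y) \<longlongrightarrow> metric_ginv A y) (at_right 0)) \<and>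
        (\<forall>y. ((\<lambda>\<alpha>. blinfun_apply A (x \<alpha> y)) \<longlongrightarrow> range_projection A y) (at_right 0)) \<and>
        parametric_regularization A x)"
proof -
  note X = assms(1-3) and Y = assms(4-6)
  have pos: "p > 0" "q > 0" using assms(7,8) by auto
  have ex: "\<exists>x. tikhonov_minimizer p q A \<alpha> y x" if "\<alpha> > 0" for \<alpha> y
    using tikhonov_minimizer_exists[OF X(1) pos that] by metis
  have unique: "\<exists>!x. tikhonov_minimizer p q A \<alpha> y x" if "p > 1 \<or> q > 1" "\<alpha> > 0" for \<alpha> y
    using ex[OF that(2), of y] tikhonov_minimizer_unique[OF X(2) Y(2) assms(7,8) that] by metis
  have min_norm: "(\<exists>!z. min_norm_solution A y z) \<and> min_norm_solution A y (metric_ginv A y)"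
    if "y \<in> metric_ginv_domain A" for y
    using min_norm_solution_iff[OF X(1,2) Y(1,2) that] by simp
  have conv: "((\<lambda>\<alpha>. x \<alpha> y) \<longlongrightarrow> metric_ginv A y) (at_right 0)"
    if "\<forall>\<alpha>>0. \<forall>y. tikhonov_minimizer p q A \<alpha> y (x \<alpha> y)" "y \<in> metric_ginv_domain A" for x y
  proof (rule tendsto_at_right_0_sequentiallyI)
    fix \<alpha> :: "nat \<Rightarrow> real" assume \<alpha>: "\<And>n. \<alpha> n > 0" "\<alpha> \<longlonglongrightarrow> 0"
    show "(\<lambda>n. x (\<alpha> n) y) \<longlonglongrightarrow> metric_ginv A y"
      using that(1) \<alpha>(1) by (intro tikhonov_convergence[OF X Y(1,2) that(2) _ pos \<alpha>]) auto
  qed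
  have residual: "((\<lambda>\<alpha>. A (x \<alpha> y)) \<longlongrightarrow> range_projection A y) (at_right 0)"
    if "\<forall>\<alpha>>0. \<forall>y. tikhonov_minimizer p q A \<alpha> y (x \<alpha> y)" for x y
  proof (rule tendsto_at_right_0_sequentiallyI)
    fix \<alpha> :: "nat \<Rightarrow> real" assume \<alpha>: "\<And>n. \<alpha> n > 0" "\<alpha> \<longlonglongrightarrow> 0"
    show "(\<lambda>n. A (x (\<alpha> n) y)) \<longlonglongrightarrow> range_projection A y"
      using that \<alpha>(1) by (intro tikhonov_residual_convergence[OF Y _ pos \<alpha>]) auto
  qed
  show ?thesis
    unfolding parametric_regularization_def
    using ex unique min_norm conv residual by blast
qed

end
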